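(* Let $D\subset\mathbf{R}^d$ be open and bounded, $\mathcal X\subset\overline D$, and let $J:\Xi\subset\wp(D)\to\mathbf{R}$ be a shape differentiable function whose shape derivative at each $\Omega\in\Xi$ has the form $$dJ(\Omega)(X)=\int_{\mathcal X}\mathbf S_1:\partial X+\mathbf S_0\cdot X\,dx$$ with $\mathbf S_1\in L_1(\mathcal X,\mathbf{R}^{d,d})$ and $\mathbf S_0\in L_1(\mathcal X,\mathbf{R}^d)$ (which may depend on $\Omega$). Suppose $\mathcal H(\mathcal X,\mathbf{R}^d)$ is a vector-valued reproducing kernel Hilbert space with matrix-valued kernel $K(x,y)=(K_1(x,y),\dots,K_d(x,y))$, and assume $dJ(\Omega)\in(\mathcal H(\mathcal X,\mathbf{R}^d))^*$. Then the gradient $\nabla J(\Omega)$ of $J$ at $\Omega$ with respect to the $\mathcal H(\mathcal X,\mathbf{R}^d)$-metric is given pointwise, for all $y\in\mathcal X$, by $$\nabla J(\Omega)(y)=\sum_{i=1}^d\left(\int_{\mathcal X}\mathbf S_1(x):\partial_xK_i(x,y)+\mathbf S_0(x)\cdot K_i(x,y)\,dx\right)e_i,$$ where $e_1,\dots,e_d$ is the standard basis of $\mathbf{R}^d$.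
   Context: $\wp(D)$ is the power set of $D$; $\partial X$ is the Jacobian of $X$, and $A:B=\sum_{ij}A_{ij}B_{ij}$. The shape derivative of $J$ at $\Omega$ in direction $X$ is $dJ(\Omega)(X)=\lim_{t\searrow0}(J(\Phi_t(\Omega))-J(\Omega))/t$, where $\Phi_t$ is the flow of the vector field $X$; $J$ is shape differentiable at $\Omega$ if, for some $k\ge1$, this limit exists for all $k$-times continuously differentiable $X:\overline D\to\mathbf{R}^d$ vanishing on $\partial D$ and is linear and continuous in such $X$. By means of the integral formula, $dJ(\Omega)$ is regarded as defined on more general vector fields on $\mathcal X$. A function $K:\mathcal X\times\mathcal X\to\mathbf{R}^{d,d}$ is a matrix-valued reproducing kernel for a real Hilbert space $\mathcal H=\mathcal H(\mathcal X,\mathbf{R}^d)$ of functions $\mathcal X\to\mathbf{R}^d$ if (i) $K(x,\cdot)a\in\mathcal H$ for every $x\in\mathcal X$, $a\in\mathbf{R}^d$, and (ii) $(K(x,\cdot)a,f)_{\mathcal H}=a\cdot f(x)$ for all $f\in\mathcal H$, $x\in\mathcal X$, $a\in\mathbf{R}^d$; then $\mathcal H$ is called a vector-valued reproducing kernel Hilbert space with kernel $K$. $K_i(x,y)=K(x,y)e_i$ is the $i$-th column of $K(x,y)$, and $\partial_xK_i(x,y)$ its Jacobian in $x$. The assumption $dJ(\Omega)\in\mathcal H^*$ means that the integral formula for $dJ(\Omega)(X)$ defines a continuous linear functional on $\mathcal H$. The gradient $\nabla J(\Omega)\in\mathcal H$ is defined by $(\nabla J(\Omega),\varphi)_{\mathcal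 H}=dJ(\Omega)(\varphi)$ for all $\varphi\in\mathcal H$. Typically $\mathcal X$ is $\Omega$ or $D$.
   Formalization: The displayed formula fails for kernels with non-symmetric matrix values; it is proved as displayed when all matrices K(x,y) are symmetric, and for every kernel with K_i(x,y) replaced by K_i(y,x), with the Jacobian still taken in x. *)

theory Defs
  imports "HOL-Analysis.Analysis"
begin

section \<open>Vector fields that vanish on the boundary\<close>

text \<open>\<open>iter_partial [i\<^sub>1, \<dots>, i\<^sub>m] f\<close> is \<open>\<partial>\<^bsub>i\<^sub>1\<^esub> \<dots> \<partial>\<^bsub>i\<^sub>m\<^esub> f\<close>.  It is only evaluated on the
  open set \<open>D\<close> and for \<open>f\<close> sufficiently often differentiable there.\<close>

primrec iter_partial ::
  "'n::finite list \<Rightarrow> (real^'n \<Rightarrow> real^'n) \<Rightarrow> real^'n \<Rightarrow> real^'n" where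
  "iter_partial [] f = f"
| "iter_partial (i # is) f = (\<lambda>x. frechet_derivative (iter_partial is f) (at x) (axis i 1))"

text \<open>\<open>C\<^sup>k\<close> up to the boundary: \<open>f\<close> is \<open>k\<close> times differentiable on the open set \<open>D\<close> and its
  partial derivatives of order at most \<open>k\<close> extend continuously to \<open>closure D\<close>.\<close>

definition Ck_closure :: "nat \<Rightarrow> (real^'n::finite) set \<Rightarrow> (real^'n \<Rightarrow> real^'n) \<Rightarrow> bool" where
  "Ck_closure k D f \<longleftrightarrow>
     continuous_on (closure D) f \<and>
     (\<forall>is. length is < k \<longrightarrow> (\<forall>x\<in>D. iter_partial is f differentiable (at x))) \<and>
     (\<forall>is. length is \<le> k \<longrightarrow>
        (\<exists>g. continuous_on (closure D) g \<and> (\<forall>x\<in>D. g x = iter_partial is f x)))"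

definition Ck_vanishing :: "nat \<Rightarrow> (real^'n::finite) set \<Rightarrow> (real^'n \<Rightarrow> real^'n) set" where
  "Ck_vanishing k D = {X. Ck_closure k D X \<and> (\<forall>x\<in>frontier D. X x = 0)}"

text \<open>For members of \<open>Ck_closure k D\<close> the supremum over \<open>D\<close> equals that over \<open>closure D\<close>.\<close>

definition Ck_norm :: "nat \<Rightarrow> (real^'n::finite) set \<Rightarrow> (real^'n \<Rightarrow> real^'n) \<Rightarrow> real" where
  "Ck_norm k D f = (SUP p\<in>{is. length is \<le> k} \<times> D. norm (iter_partial (fst p) f (snd p)))"


section \<open>Flows and shape derivatives\<close>

text \<open>\<open>flow D X t x\<close> is \<open>\<Phi>\<^sub>t(x)\<close> for \<open>t \<ge> 0\<close>.  A field in \<open>Ck_vanishing k D\<close> with \<open>k \<ge> 1\<close>, extended by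
  zero, is globally Lipschitz, so for \<open>x \<in> closure D\<close> the trajectory exists, is unique, and stays
  in \<open>closure D\<close>.\<close>

definition flow ::
  "(real^'n::finite) set \<Rightarrow> (real^'n \<Rightarrow> real^'n) \<Rightarrow> real \<Rightarrow> real^'n \<Rightarrow> real^'n" where
  "flow D X t x = (THE y. \<exists>\<gamma>. \<gamma> 0 = x \<and> \<gamma> t = y \<and>
     (\<forall>s\<in>{0..t}. \<gamma> s \<in> closure D \<and>
        (\<gamma> has_vector_derivative X (\<gamma> s)) (at s within {0..t})))"

definition shape_quotient ::
  "(real^'n::finite) set \<Rightarrow> ((real^'n) set \<Rightarrow> real) \<Rightarrow> (real^'n) set \<Rightarrow> (real^'n \<Rightarrow> real^'n)
    \<Rightarrow> real \<Rightarrow> real" where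
  "shape_quotient D J \<Omega> X t = (J (flow D X t ` \<Omega>) - J \<Omega>) / t"

definition shape_derivative ::
  "(real^'n::finite) set \<Rightarrow> ((real^'n) set \<Rightarrow> real) \<Rightarrow> (real^'n) set \<Rightarrow> (real^'n \<Rightarrow> real^'n)
    \<Rightarrow> real" where
  "shape_derivative D J \<Omega> X = Lim (at_right 0) (shape_quotient D J \<Omega> X)"

text \<open>\<open>J\<close> is a function on \<open>\<Xi>\<close> only, so existence of the limit includes that \<open>\<Phi>\<^sub>t(\<Omega>) \<in> \<Xi>\<close> for
  small \<open>t > 0\<close>.  The last conjunct is continuity of the linear map for the \<open>C\<^sup>k\<close> norm.
  \<open>J\<close> is shape differentiable at \<open>\<Omega>\<close> iff this holds for some \<open>k \<ge> 1\<close>.\<close>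

definition shape_differentiable_of_order ::
  "nat \<Rightarrow> (real^'n::finite) set \<Rightarrow> (real^'n) set set \<Rightarrow> ((real^'n) set \<Rightarrow> real) \<Rightarrow> (real^'n) set
    \<Rightarrow> bool" where
  "shape_differentiable_of_order k D \<Xi> J \<Omega> \<longleftrightarrow>
     (\<forall>X\<in>Ck_vanishing k D.
        (\<forall>\<^sub>F t in at_right 0. flow D X t ` \<Omega> \<in> \<Xi>) \<and>
        (\<exists>l. (shape_quotient D J \<Omega> X \<longlongrightarrow> l) (at_right 0))) \<and>
     (\<forall>X\<in>Ck_vanishing k D. \<forall>Y\<in>Ck_vanishing k D. \<forall>a b.
        shape_derivative D J \<Omega> (\<lambda>x. a *\<^sub>R X x + b *\<^sub>R Y x) =
        a * shape_derivative D J \<Omega> X + b * shape_derivative D J \<Omega> Y) \<and>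
     (\<exists>C. \<forall>X\<in>Ck_vanishing k D. \<bar>shape_derivative D J \<Omega> X\<bar> \<le> C * Ck_norm k D X)"


section \<open>The integral formula\<close>

definition frobenius :: "real^'n::finite^'n \<Rightarrow> real^'n^'n \<Rightarrow> real" where
  "frobenius A B = (\<Sum>i\<in>UNIV. \<Sum>j\<in>UNIV. A $ i $ j * B $ i $ j)"

text \<open>Fields are only given on \<open>S\<close>, hence the derivative within \<open>S\<close>.  For measurable \<open>S\<close> it is unique
  at the Lebesgue density points of \<open>S\<close>, that is, almost everywhere in \<open>S\<close>; at those of
  them where the field is differentiable on a neighbourhood it is the ordinary derivative.\<close>

definition jacobian_within ::
  "(real^'n::finite) set \<Rightarrow> (real^'n \<Rightarrow> real^'n) \<Rightarrow> real^'n \<Rightarrow> real^'n^'n" where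
  "jacobian_within S f x = matrix (frechet_derivative f (at x within S))"

definition shape_integrand ::
  "(real^'n::finite) set \<Rightarrow> (real^'n \<Rightarrow> real^'n^'n) \<Rightarrow> (real^'n \<Rightarrow> real^'n)
    \<Rightarrow> (real^'n \<Rightarrow> real^'n) \<Rightarrow> real^'n \<Rightarrow> real" where
  "shape_integrand S S1 S0 X x = frobenius (S1 x) (jacobian_within S X x) + S0 x \<bullet> X x"

definition shape_form ::
  "(real^'n::finite) set \<Rightarrow> (real^'n \<Rightarrow> real^'n^'n) \<Rightarrow> (real^'n \<Rightarrow> real^'n)
    \<Rightarrow> (real^'n \<Rightarrow> real^'n) \<Rightarrow> real" where
  "shape_form S S1 S0 X = (LINT x|lebesgue_on S. shape_integrand S S1 S0 X x)"


section \<open>Vector-valued reproducing kernel Hilbert spaces\<close>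

text \<open>A Hilbert space of functions \<open>S \<rightarrow> \<real>\<^sup>d\<close> is a type \<open>'h\<close> of class \<open>{real_inner, complete_space}\<close>
  together with \<open>ev\<close>, where \<open>ev f x\<close> is the value of \<open>f\<close> at \<open>x \<in> S\<close>: the vector space operations
  are pointwise on \<open>S\<close>, and elements are determined by their values on \<open>S\<close>.
  Values of \<open>ev f\<close> outside \<open>S\<close> carry no meaning.\<close>

definition hilbert_function_space ::
  "(real^'n::finite) set \<Rightarrow> ('h::{real_inner,complete_space} \<Rightarrow> real^'n \<Rightarrow> real^'n) \<Rightarrow> bool" where
  "hilbert_function_space S ev \<longleftrightarrow>
     (\<forall>x\<in>S. linear (\<lambda>f. ev f x)) \<and>
     (\<forall>f g. (\<forall>x\<in>S. ev f x = ev g x) \<longrightarrow> f = g)"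

text \<open>The element \<open>h\<close> below is \<open>K(x,\<cdot>)a\<close>, so the representer of \<open>f \<mapsto> f\<^sub>i(y)\<close> is the function
  \<open>x \<mapsto> K(y,x)e\<^sub>i\<close>.  As \<open>K(x,y)\<close> is the transpose of \<open>K(y,x)\<close>, it coincides with \<open>x \<mapsto> K(x,y)e\<^sub>i\<close>
  if the matrices \<open>K(x,y)\<close> are symmetric, but not in general.\<close>

definition reproducing_kernel ::
  "(real^'n::finite) set \<Rightarrow> ('h::{real_inner,complete_space} \<Rightarrow> real^'n \<Rightarrow> real^'n)
    \<Rightarrow> (real^'n \<Rightarrow> real^'n \<Rightarrow> real^'n^'n) \<Rightarrow> bool" where
  "reproducing_kernel S ev K \<longleftrightarrow>
     (\<forall>x\<in>S. \<forall>a. \<exists>h. (\<forall>y\<in>S. ev h y = K x y *v a) \<and> (\<forall>f. h \<bullet> f = a \<bullet> ev f x))"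

text \<open>The integral formula defines a continuous linear functional on the Hilbert space; this
  includes that the Jacobian and the integral in it make sense for every element.\<close>

definition shape_form_in_dual ::
  "(real^'n::finite) set \<Rightarrow> ('h::{real_inner,complete_space} \<Rightarrow> real^'n \<Rightarrow> real^'n)
    \<Rightarrow> (real^'n \<Rightarrow> real^'n^'n) \<Rightarrow> (real^'n \<Rightarrow> real^'n) \<Rightarrow> bool" where
  "shape_form_in_dual S ev S1 S0 \<longleftrightarrow>
     (\<forall>f. (AE x in lebesgue_on S. ev f differentiable (at x within S)) \<and>
          integrable (lebesgue_on S) (shape_integrand S S1 S0 (ev f))) \<and>
     bounded_linear (\<lambda>f. shape_form S S1 S0 (ev f))"

text \<open>If the integral formula is in the dual, existence and uniqueness are the Riesz
  representation theorem.\<close>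

definition shape_gradient ::
  "(real^'n::finite) set \<Rightarrow> ('h::{real_inner,complete_space} \<Rightarrow> real^'n \<Rightarrow> real^'n)
    \<Rightarrow> (real^'n \<Rightarrow> real^'n^'n) \<Rightarrow> (real^'n \<Rightarrow> real^'n) \<Rightarrow> 'h" where
  "shape_gradient S ev S1 S0 = (THE g. \<forall>\<phi>. g \<bullet> \<phi> = shape_form S S1 S0 (ev \<phi>))"

end

theory Submission
  imports Defs
begin

text \<open>The gradient exists by the Riesz representation theorem. Pairing it with the representer
  \<open>K(y,\<cdot>)e\<^sub>i\<close> of \<open>f \<mapsto> f\<^sub>i(y)\<close> gives, on the one hand, the \<open>i\<close>-th component of the gradient at \<open>y\<close>
  and, on the other hand, the integral formula evaluated at \<open>K(y,\<cdot>)e\<^sub>i\<close>. Since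
  \<open>K(x,y) = K(y,x)\<^sup>T\<close>, the arguments may be swapped when all matrices are symmetric.\<close>

text \<open>The representing vector is the minimiser of \<open>Q\<close>; the parallelogram law makes minimising
  sequences Cauchy.\<close>

lemma riesz_representation:
  fixes f :: "'a::{real_inner,complete_space} \<Rightarrow> real"
  assumes "bounded_linear f"
  shows "\<exists>g. \<forall>x. g \<bullet> x = f x"
proof -
  interpret f: bounded_linear f by fact
  \<comment> \<open>If \<open>g\<close> represents \<open>f\<close>, completing the square gives
    \<open>Q x = (norm (x - g))^2 - (norm g)^2\<close>, so a minimiser of \<open>Q\<close> is the
    natural candidate.\<close>
  define Q where "Q x = (norm x)\<^sup>2 - 2 * f x" for x
  obtain B where B: "\<And>x. norm (f x) \<le> norm x * B"
    using f.bounded by blast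
  have "- B\<^sup>2 \<le> Q x" for x
  proof -
    have "0 \<le> (norm x - B)\<^sup>2" by simp
    moreover have "f x \<le> norm x * B" using B[of x] by simp
    ultimately show ?thesis by (simp add: Q_def power2_diff)
  qed
  then have bdd: "bdd_below (range Q)" by (auto intro!: bdd_belowI)
  define m where "m = Inf (range Q)"
  have m_le: "m \<le> Q x" for x
    unfolding m_def by (rule cInf_lower[OF _ bdd]) simp
  have "\<exists>x. Q x < m + 1 / real (Suc n)" for n
    using cInf_lessD[of "range Q" "m + 1 / real (Suc n)"] by (auto simp: m_def)
  then obtain u where u: "\<And>n. Q (u n) < m + 1 / real (Suc n)" by metis
  have Q_lim: "(\<lambda>n. Q (u n)) \<longlonglongrightarrow> m"
  proof (rule tendsto_sandwich[OF _ _ tendsto_const])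
    show "(\<lambda>n. m + 1 / real (Suc n)) \<longlonglongrightarrow> m"
      using tendsto_add[OF tendsto_const lim_inverse_n', of m] LIMSEQ_Suc by fastforce
  qed (use m_le u in \<open>auto intro!: always_eventually less_imp_le\<close>)
  have parallelogram: "(norm (x - y))\<^sup>2 \<le> 2 * (Q x - m) + 2 * (Q y - m)" for x y
  proof -
    \<comment> \<open>The linear terms cancel, leaving the parallelogram law; the value of
      \<open>Q\<close> at the midpoint is then bounded below by \<open>m\<close>.\<close>
    have "(norm (x - y))\<^sup>2 = 2 * Q x + 2 * Q y - 4 * Q ((1/2) *\<^sub>R (x + y))"
      unfolding Q_def power2_norm_eq_inner f.scaleR f.add
      by (simp add: algebra_simps inner_commute)
    with m_le[of "(1/2) *\<^sub>R (x + y)"] show ?thesis by simp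
  qed
  have "Cauchy u"
  proof (rule metric_CauchyI)
    fix e :: real assume "0 < e"
    then have "eventually (\<lambda>n. Q (u n) < m + e\<^sup>2 / 4) sequentially"
      by (intro order_tendstoD(2)[OF Q_lim]) simp
    then obtain N where N: "\<And>n. N \<le> n \<Longrightarrow> Q (u n) < m + e\<^sup>2 / 4"
      by (auto simp: eventually_sequentially)
    have "dist (u i) (u j) < e" if "N \<le> i" "N \<le> j" for i j
    proof -
      have "(norm (u i - u j))\<^sup>2 < e\<^sup>2"
        using parallelogram[of "u i" "u j"] N[OF that(1)] N[OF that(2)] by argo
      with \<open>0 < e\<close> show ?thesis by (simp add: dist_norm power_less_imp_less_base)
    qed
    then show "\<exists>N. \<forall>i\<ge>N. \<forall>j\<ge>N. dist (u i) (u j) < e" by blast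
  qed
  then obtain g where g: "u \<longlonglongrightarrow> g" using Cauchy_convergent convergent_def by blast
  have "(\<lambda>n. Q (u n)) \<longlonglongrightarrow> Q g"
    unfolding Q_def by (intro tendsto_intros f.tendsto g)
  then have Qg: "Q g = m" using Q_lim LIMSEQ_unique by blast
  have "g \<bullet> x = f x" for x
  proof (cases "x = 0")
    case False
    define c where "c = g \<bullet> x - f x"
    \<comment> \<open>This \<open>t\<close> minimises the quadratic
      \<open>2 * t * c + t * t * (x \<bullet> x)\<close>, the change of \<open>Q\<close> along the
      line through \<open>g\<close> in direction \<open>x\<close>; its least value is negative
      unless \<open>c = 0\<close>.\<close>
    define t where "t = - c / (x \<bullet> x)"
    have "0 \<le> Q (g + t *\<^sub>R x) - Q g" using m_le Qg by simp
    also have "\<dots> = 2 * t * c + t * t * (x \<bullet> x)"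
      unfolding Q_def power2_norm_eq_inner f.scaleR f.add c_def
      by (simp add: algebra_simps inner_commute)
    also have "\<dots> = - (c\<^sup>2 / (x \<bullet> x))"
      using False by (simp add: t_def field_simps power2_eq_square)
    finally have "c\<^sup>2 / (x \<bullet> x) \<le> 0" by simp
    moreover have "0 < x \<bullet> x" using False by simp
    ultimately have "c = 0" by (auto simp: divide_le_0_iff)
    then show ?thesis by (simp add: c_def)
  qed (simp add: f.zero)
  then show ?thesis by blast
qed

text \<open>Turns the definite description into a usable equation: Riesz gives existence, and a
  vector is determined by its inner products with all vectors.\<close>

lemma shape_gradient_inner:
  fixes ev :: "'h::{real_inner,complete_space} \<Rightarrow> real^'n::finite \<Rightarrow> real^'n"
  assumes "shape_form_in_dual S ev S1 S0"
  shows "shape_gradient S ev S1 S0 \<bullet> \<phi> = shape_form S S1 S0 (ev \<phi>)"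
proof -
  let ?P = "\<lambda>g. \<forall>\<phi>. g \<bullet> \<phi> = shape_form S S1 S0 (ev \<phi>)"
  have "\<exists>g. ?P g"
    using assms unfolding shape_form_in_dual_def by (intro riesz_representation) blast
  moreover have "g = h" if "?P g" "?P h" for g h
    using that by (metis vector_eq_rdot)
  ultimately have "\<exists>!g. ?P g" by blast
  from theI'[OF this] show ?thesis unfolding shape_gradient_def by blast
qed

lemma jacobian_within_cong:
  assumes "\<And>x. x \<in> S \<Longrightarrow> f x = g x" and "x \<in> S"
  shows "jacobian_within S f x = jacobian_within S g x"
proof -
  \<comment> \<open>Both fields have the same set of derivatives within \<open>S\<close>, so the
    choice in \<open>frechet_derivative\<close> agrees even where a derivative is missing or not
    unique.\<close>
  have "(f has_derivative f') (at x within S) \<longleftrightarrow> (g has_derivative f') (at x within S)" for f'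
    using assms has_derivative_transform[of x S f g f'] has_derivative_transform[of x S g f f'] by auto
  then show ?thesis by (simp add: jacobian_within_def frechet_derivative_def)
qed

text \<open>An element of the Hilbert space matches a kernel column only on \<open>S\<close>; this
  allows one to replace the other under the integral.\<close>

lemma shape_form_cong:
  assumes "\<And>x. x \<in> S \<Longrightarrow> X x = Y x"
  shows "shape_form S S1 S0 X = shape_form S S1 S0 Y"
  unfolding shape_form_def
proof (rule Bochner_Integration.integral_cong[OF refl])
  fix x assume "x \<in> space (lebesgue_on S)"
  then have "x \<in> S" by simp
  then show "shape_integrand S S1 S0 X x = shape_integrand S S1 S0 Y x"
    using assms jacobian_within_cong[of S X Y x] by (simp add: shape_integrand_def)
qed

text \<open>For the representers \<open>h\<close> of \<open>K(x,.)b\<close> and \<open>k\<close> of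
  \<open>K(y,.)a\<close>, the reproducing property evaluates \<open>h \<bullet> k\<close> in two
  ways, and the inner product is symmetric.\<close>

lemma reproducing_kernel_transpose:
  assumes "reproducing_kernel S ev K" and "x \<in> S" "y \<in> S"
  shows "transpose (K x y) = K y x"
proof -
  have "transpose (K x y) *v a = K y x *v a" for a
  proof (rule vector_eq_ldot[THEN iffD1, rule_format])
    fix b
    obtain h where h: "\<forall>z\<in>S. ev h z = K x z *v b" "\<forall>f. h \<bullet> f = b \<bullet> ev f x"
      using assms unfolding reproducing_kernel_def by blast
    obtain k where k: "\<forall>z\<in>S. ev k z = K y z *v a" "\<forall>f. k \<bullet> f = a \<bullet> ev f y"
      using assms unfolding reproducing_kernel_def by blast
    have "b \<bullet> (transpose (K x y) *v a) = a \<bullet> ev h y"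
      using h(1) assms(3) dot_lmul_matrix[of a "K x y" b] by (simp add: inner_commute)
    also have "\<dots> = b \<bullet> ev k x"
      using h(2) k(2) by (metis inner_commute)
    also have "\<dots> = b \<bullet> (K y x *v a)"
      using k(1) assms(2) by simp
    finally show "b \<bullet> (transpose (K x y) *v a) = b \<bullet> (K y x *v a)" .
  qed
  then show ?thesis by (simp add: matrix_eq)
qed

text \<open>The point \<open>y\<close> sits in the first slot of \<open>K\<close> because the
  representer of the \<open>i\<close>-th component at \<open>y\<close> is \<open>K(y,.)\<close>
  applied to \<open>axis i 1\<close>.\<close>

lemma shape_gradient_kernel:
  fixes ev :: "'h::{real_inner,complete_space} \<Rightarrow> real^'n::finite \<Rightarrow> real^'n"
  assumes "reproducing_kernel S ev K" and "shape_form_in_dual S ev S1 S0" and "y \<in> S"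
  shows "ev (shape_gradient S ev S1 S0) y =
    (\<Sum>i\<in>UNIV. shape_form S S1 S0 (\<lambda>x. column i (K y x)) *\<^sub>R axis i 1)"
proof -
  let ?G = "shape_gradient S ev S1 S0"
  have component: "ev ?G y $ i = shape_form S S1 S0 (\<lambda>x. column i (K y x))" for i
  proof -
    obtain h where h: "\<forall>x\<in>S. ev h x = K y x *v axis i 1" "\<forall>f. h \<bullet> f = axis i 1 \<bullet> ev f y"
      using assms(1,3) unfolding reproducing_kernel_def by blast
    have "ev ?G y $ i = ?G \<bullet> h"
      using h(2) by (metis cart_eq_inner_axis inner_commute)
    also have "\<dots> = shape_form S S1 S0 (ev h)"
      using assms(2) by (rule shape_gradient_inner)
    also have "\<dots> = shape_form S S1 S0 (\<lambda>x. column i (K y x))"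
      using h(1) by (intro shape_form_cong) (simp add: matrix_vector_mult_basis)
    finally show ?thesis .
  qed
  show ?thesis
    unfolding component[symmetric]
    using basis_expansion[of "ev ?G y"] by (simp add: scalar_mult_eq_scaleR)
qed

theorem lemma3p9:
  fixes D :: "(real^'n::finite) set"
    and \<X> :: "(real^'n) set \<Rightarrow> (real^'n) set"
    and \<Xi> :: "(real^'n) set set"
    and J :: "(real^'n) set \<Rightarrow> real"
    and S1 :: "(real^'n) set \<Rightarrow> real^'n \<Rightarrow> real^'n^'n"
    and S0 :: "(real^'n) set \<Rightarrow> real^'n \<Rightarrow> real^'n"
    and \<Omega> :: "(real^'n) set"
    and ev :: "'h::{real_inner,complete_space} \<Rightarrow> real^'n \<Rightarrow> real^'n"
    and K :: "real^'n \<Rightarrow> real^'n \<Rightarrow> real^'n^'n"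
  assumes "open D" and "bounded D"
    and "\<Xi> \<subseteq> Pow D"
    and "\<And>A. A \<in> \<Xi> \<Longrightarrow> \<X> A \<subseteq> closure D \<and> \<X> A \<in> sets lebesgue"
    and "\<And>A. A \<in> \<Xi> \<Longrightarrow> integrable (lebesgue_on (\<X> A)) (S1 A)"
    and "\<And>A. A \<in> \<Xi> \<Longrightarrow> integrable (lebesgue_on (\<X> A)) (S0 A)"
    and "\<And>A. A \<in> \<Xi> \<Longrightarrow> \<exists>k\<ge>1. shape_differentiable_of_order k D \<Xi> J A \<and>
           (\<forall>X\<in>Ck_vanishing k D.
              shape_derivative D J A X = shape_form (\<X> A) (S1 A) (S0 A) X)"
    and "\<Omega> \<in> \<Xi>"
    and "hilbert_function_space (\<X> \<Omega>) ev"
    and "reproducing_kernel (\<X> \<Omega>) ev K"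
    and "shape_form_in_dual (\<X> \<Omega>) ev (S1 \<Omega>) (S0 \<Omega>)"
  shows "(\<forall>y\<in>\<X> \<Omega>.
            ev (shape_gradient (\<X> \<Omega>) ev (S1 \<Omega>) (S0 \<Omega>)) y =
            (\<Sum>i\<in>UNIV. (LINT x|lebesgue_on (\<X> \<Omega>).
               frobenius (S1 \<Omega> x) (jacobian_within (\<X> \<Omega>) (\<lambda>x. column i (K y x)) x)
               + S0 \<Omega> x \<bullet> column i (K y x)) *\<^sub>R axis i 1)) \<and>
         ((\<forall>x\<in>\<X> \<Omega>. \<forall>y\<in>\<X> \<Omega>. transpose (K x y) = K x y) \<longrightarrow>
          (\<forall>y\<in>\<X> \<Omega>.
            ev (shape_gradient (\<X> \<Omega>) ev (S1 \<Omega>) (S0 \<Omega>)) y =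
            (\<Sum>i\<in>UNIV. (LINT x|lebesgue_on (\<X> \<Omega>).
               frobenius (S1 \<Omega> x) (jacobian_within (\<X> \<Omega>) (\<lambda>x. column i (K x y)) x)
               + S0 \<Omega> x \<bullet> column i (K x y)) *\<^sub>R axis i 1)))"
proof -
  let ?S = "\<X> \<Omega>"
  have gradient: "ev (shape_gradient ?S ev (S1 \<Omega>) (S0 \<Omega>)) y =
      (\<Sum>i\<in>UNIV. shape_form ?S (S1 \<Omega>) (S0 \<Omega>) (\<lambda>x. column i (K y x)) *\<^sub>R axis i 1)"
    if "y \<in> ?S" for y
    using assms(10,11) that by (rule shape_gradient_kernel)
  \<comment> \<open>On \<open>S\<close>, \<open>K y x\<close> is the transpose of
    \<open>K x y\<close>, which equals \<open>K x y\<close> under the symmetry assumption; hence the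
    columns agree as fields in \<open>x\<close>.\<close>
  have swap: "shape_form ?S (S1 \<Omega>) (S0 \<Omega>) (\<lambda>x. column i (K y x)) =
      shape_form ?S (S1 \<Omega>) (S0 \<Omega>) (\<lambda>x. column i (K x y))"
    if "\<forall>x\<in>?S. \<forall>y\<in>?S. transpose (K x y) = K x y" "y \<in> ?S" for y i
    using that reproducing_kernel_transpose[OF assms(10)]
    by (intro shape_form_cong) metis
  show ?thesis
    using gradient swap unfolding shape_form_def shape_integrand_def by simp
qed

end
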